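(* Let $n\equiv 1\pmod 4$. Then for each integer $\beta$ with $0\leq \beta\leq n-5$ there exists a Heffter array $H(n;3)$, denoted $L$, with the following properties: (i) the non-empty cells of $L$ are exactly the cells of the diagonals $D_{\beta}$, $D_{\beta+2}$ and $D_{\beta+4}$; (ii) the support of $D_{\beta+2}$ in $L$ is $\{1,\dots,n\}$; (iii) the support of $D_\beta\cup D_{\beta+4}$ in $L$ is $\{n+1,\dots,3n\}$; (iv) all entries of $L$ on $D_{\beta}$ are positive; (v) all entries of $L$ on $D_{\beta+4}$ are negative; (vi) the array $M$ defined by $M(i,j)=L(i+1,j+1)$ for $i,j\in\{0,\dots,n-1\}$ (indices modulo $n$) also satisfies properties (i)–(v) and is a Heffter array $H(n;3)$.
   Context: A Heffter array $H(n;k)$ is an $n\times n$ array of integers (some cells may be empty) such that: each row and each column contains exactly $k$ filled cells; the entries in every row and every column sum to $0$ modulo $2nk+1$; and for each integer $1\leq x\leq nk$, either $x$ or $-x$ appears in the array. Rows and columns are indexed by $0,\dots,n-1$, with indices computed modulo $n$; $L(i,j)$ denotes the entry in row $i$, column $j$. For $d\in\{0,\dots,n-1\}$ the diagonal $D_d$ is the set of cells $\{(i+d \bmod n,\ i): i=0,\dots,n-1\}$. The support of a set of cells of $L$ is the set of absolute values of the entries of $L$ in those cells. *)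

theory Defs
  imports Main "HOL-Number_Theory.Cong"
begin

text \<open>
  An n by n array with possibly empty cells is a function
  L :: nat \<Rightarrow> nat \<Rightarrow> int option, where L i j is the content of row i, column j and None
  means empty. Only the values at indices i, j < n are relevant.
\<close>

type_synonym array = "nat \<Rightarrow> nat \<Rightarrow> int option"

definition filled_cells :: "nat \<Rightarrow> array \<Rightarrow> (nat \<times> nat) set" where
  "filled_cells n L = {(i, j). i < n \<and> j < n \<and> L i j \<noteq> None}"

definition heffter_array :: "nat \<Rightarrow> nat \<Rightarrow> array \<Rightarrow> bool" where
  "heffter_array n k L \<longleftrightarrow>
     (\<forall>i<n. card {j. (i, j) \<in> filled_cells n L} = k) \<and>
     (\<forall>j<n. card {i. (i, j) \<in> filled_cells n L} = k) \<and>
     (\<forall>i<n. [(\<Sum>j | (i, j) \<in> filled_cells n L. the (L i j)) = 0] (mod (2 * int n * int k + 1))) \<and>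
     (\<forall>j<n. [(\<Sum>i | (i, j) \<in> filled_cells n L. the (L i j)) = 0] (mod (2 * int n * int k + 1))) \<and>
     (\<forall>x. 1 \<le> x \<and> x \<le> int n * int k \<longrightarrow>
        (\<exists>i<n. \<exists>j<n. L i j = Some x \<or> L i j = Some (- x)))"

definition diagonal :: "nat \<Rightarrow> nat \<Rightarrow> (nat \<times> nat) set" where
  "diagonal n d = {((i + d) mod n, i) | i. i < n}"

definition entries_on :: "array \<Rightarrow> (nat \<times> nat) set \<Rightarrow> int set" where
  "entries_on L S = {v. \<exists>(i, j)\<in>S. L i j = Some v}"

definition support_on :: "array \<Rightarrow> (nat \<times> nat) set \<Rightarrow> int set" where
  "support_on L S = abs ` entries_on L S"

definition shift_array :: "nat \<Rightarrow> array \<Rightarrow> array" where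
  "shift_array n L = (\<lambda>i j. L ((i + 1) mod n) ((j + 1) mod n))"

definition three_diagonal_properties :: "nat \<Rightarrow> nat \<Rightarrow> array \<Rightarrow> bool" where
  "three_diagonal_properties n \<beta> L \<longleftrightarrow>
     filled_cells n L = diagonal n \<beta> \<union> diagonal n (\<beta> + 2) \<union> diagonal n (\<beta> + 4) \<and>
     support_on L (diagonal n (\<beta> + 2)) = {1..int n} \<and>
     support_on L (diagonal n \<beta> \<union> diagonal n (\<beta> + 4)) = {int n + 1..3 * int n} \<and>
     (\<forall>v\<in>entries_on L (diagonal n \<beta>). v > 0) \<and>
     (\<forall>v\<in>entries_on L (diagonal n (\<beta> + 4)). v < 0)"

end

theory Submission imports Defs begin

text \<open>
  Write the entries of column \<open>j\<close> on \<open>D\<^sub>\<beta>\<close>, \<open>D\<^sub>\<beta>\<^sub>+\<^sub>2\<close>, \<open>D\<^sub>\<beta>\<^sub>+\<^sub>4\<close> as \<open>a j\<close>, \<open>b j\<close>, \<open>c j\<close>. With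
  \<open>a j = 4n + 1 - D j\<close>, \<open>b j = D j + D (j + 2) - (4n + 1)\<close> and \<open>c j = - D (j + 2)\<close> all row and
  column sums vanish identically, for any \<open>n\<close>-periodic \<open>D\<close>. As \<open>n\<close> is odd, \<open>2\<close> generates the
  integers mod \<open>n\<close>, so \<open>D (2 t) = d t\<close> for an \<open>n\<close>-periodic \<open>d\<close>. Put \<open>d t = 2n + 1 + r t\<close> for even \<open>t < n\<close>
  and \<open>d t = 2n - r t\<close> for odd \<open>t < n\<close>. The support conditions now say that \<open>r\<close> is a graceful
  labelling of the path with \<open>n\<close> vertices by \<open>0, \<dots>, n - 1\<close> whose two end labels add up to \<open>n - 1\<close>
  (the edge closing the cycle then contributes \<open>n\<close> to the support of \<open>b\<close>). For \<open>n = 4k + 1\<close> such a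
  labelling is the zigzag \<open>k, 3k + 1, k - 1, 3k + 2, \<dots>, 1, 4k, 0\<close> followed by the zigzag
  \<open>2k, 2k + 1, 2k - 1, 2k + 2, \<dots>, k + 1, 3k\<close>.
\<close>

section \<open>Arrays carried by three diagonals\<close>

definition diagonal_array ::
  "nat \<Rightarrow> nat \<Rightarrow> (nat \<Rightarrow> int) \<Rightarrow> (nat \<Rightarrow> int) \<Rightarrow> (nat \<Rightarrow> int) \<Rightarrow> array" where
  "diagonal_array n \<beta> a b c = (\<lambda>i j.
     if [i = j + \<beta>] (mod n) then Some (a j)
     else if [i = j + \<beta> + 2] (mod n) then Some (b j)
     else if [i = j + \<beta> + 4] (mod n) then Some (c j)
     else None)"

lemma not_cong_add_small:
  fixes x y m n :: nat
  assumes "0 < m" "m < n" "[y = x] (mod n)"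
  shows "\<not> [y = x + m] (mod n)"
proof
  assume "[y = x + m] (mod n)"
  then have "[x + m = x] (mod n)" by (rule cong_trans[OF cong_sym assms(3)])
  then have "[m = 0] (mod n)" by (simp only: cong_add_lcancel_0_nat)
  then show False using assms(1,2) by (simp add: cong_def)
qed

text \<open>The offsets differ by 2 or 4, which lie strictly between 0 and \<open>n\<close>, so the
  three diagonals are disjoint.\<close>

lemma not_cong_diagonals:
  fixes x y n :: nat
  assumes "5 \<le> n"
  shows "[y = x] (mod n) \<Longrightarrow> \<not> [y = x + 2] (mod n)"
    and "[y = x] (mod n) \<Longrightarrow> \<not> [y = x + 4] (mod n)"
    and "[y = x + 2] (mod n) \<Longrightarrow> \<not> [y = x + 4] (mod n)"
  using assms not_cong_add_small[of 2 n y x] not_cong_add_small[of 4 n y x]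
    not_cong_add_small[of 2 n y "x + 2"]
  by (simp_all add: add.assoc del: add_2_eq_Suc')

lemma cong_iff_eq_mod: "i < n \<Longrightarrow> [i = x] (mod n) \<longleftrightarrow> i = x mod n" for i n x :: nat
  by (simp add: cong_def)

text \<open>Moving both indices by one keeps their difference modulo \<open>n\<close>, so each
  diagonal is preserved and only the sequences advance. This makes (vi) another instance of the
  criterion for a single array.\<close>

lemma shift_diagonal_array:
  assumes "\<And>j. a (j mod n) = a j" "\<And>j. b (j mod n) = b j" "\<And>j. c (j mod n) = c j"
  shows "shift_array n (diagonal_array n \<beta> a b c)
       = diagonal_array n \<beta> (a \<circ> Suc) (b \<circ> Suc) (c \<circ> Suc)"
proof -
  have "[(i + 1) mod n = (j + 1) mod n + x] (mod n) \<longleftrightarrow> [i = j + x] (mod n)" for i j x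
  proof -
    have "[(i + 1) mod n = (j + 1) mod n + x] (mod n) \<longleftrightarrow> [i + 1 = (j + x) + 1] (mod n)"
      by (simp add: cong_def mod_simps)
    also have "\<dots> \<longleftrightarrow> [i = j + x] (mod n)" by (rule cong_add_rcancel_nat)
    finally show ?thesis .
  qed
  then show ?thesis
    unfolding shift_array_def diagonal_array_def by (simp only: assms add.assoc comp_apply Suc_eq_plus1)
qed

lemma range_comp_Suc_periodic:
  fixes f :: "nat \<Rightarrow> 'a"
  assumes "0 < n" "\<And>j. f (j mod n) = f j"
  shows "range (f \<circ> Suc) = range f"
proof -
  have "f j = (f \<circ> Suc) (j + (n - 1))" for j
    using assms(1) assms(2)[of j] assms(2)[of "j + n"] by simp
  then show ?thesis by fastforce
qed

lemma image_lessThan_periodic: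
  fixes f :: "nat \<Rightarrow> 'a"
  assumes "0 < n" "\<And>j. f (j mod n) = f j"
  shows "f ` {..<n} = range f"
proof -
  have "f j \<in> f ` {..<n}" for j
    using assms by (metis imageI lessThan_iff mod_less_divisor)
  then show ?thesis by auto
qed

text \<open>The row that meets \<open>c\<close> in column \<open>x\<close> meets \<open>b\<close> in
  column \<open>x + 2\<close> and \<open>a\<close> in column \<open>x + 4\<close>; hence the shifts
  in \<open>row\<close>. All sums vanish as integers, so the modulus plays no part in them.\<close>

lemma diagonal_array_properties:
  fixes n \<beta> :: nat and a b c :: "nat \<Rightarrow> int"
  assumes n: "\<beta> + 5 \<le> n"
    and per: "\<And>j. a (j mod n) = a j" "\<And>j. b (j mod n) = b j" "\<And>j. c (j mod n) = c j"
    and col: "\<And>j. a j + b j + c j = 0"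
    and row: "\<And>j. a (j + 4) + b (j + 2) + c j = 0"
    and suppb: "abs ` range b = {1..int n}"
    and suppac: "abs ` (range a \<union> range c) = {int n + 1..3 * int n}"
    and pos: "\<And>j. a j > 0" and neg: "\<And>j. c j < 0"
  defines "L \<equiv> diagonal_array n \<beta> a b c"
  shows "heffter_array n 3 L" "three_diagonal_properties n \<beta> L"
proof -
  have n5: "5 \<le> n" and n0: "0 < n" using n by auto
  note ne = not_cong_diagonals[OF n5]
  note images = image_lessThan_periodic[where f = a, OF n0 per(1)] image_lessThan_periodic[where f = b, OF n0 per(2)]
    image_lessThan_periodic[where f = c, OF n0 per(3)]
  have L: "[i = j + \<beta>] (mod n) \<Longrightarrow> L i j = Some (a j)"
    "[i = j + \<beta> + 2] (mod n) \<Longrightarrow> L i j = Some (b j)"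
    "[i = j + \<beta> + 4] (mod n) \<Longrightarrow> L i j = Some (c j)" for i j
    using ne[of i "j + \<beta>"] by (auto simp: L_def diagonal_array_def)
  have L_filled: "L i j \<noteq> None \<longleftrightarrow>
      [i = j + \<beta>] (mod n) \<or> [i = j + \<beta> + 2] (mod n) \<or> [i = j + \<beta> + 4] (mod n)" for i j
    by (simp add: L_def diagonal_array_def)
  have card3: "x mod n \<noteq> (x + 2) mod n" "x mod n \<noteq> (x + 4) mod n" "(x + 2) mod n \<noteq> (x + 4) mod n"
    for x using ne[of x x] ne[of "x + 2" x] by (auto simp: cong_def)
  have columns: "{i. (i, j) \<in> filled_cells n L} =
      {(j + \<beta>) mod n, (j + \<beta> + 2) mod n, (j + \<beta> + 4) mod n}" if "j < n" for j
    using that n0 cong_iff_eq_mod[of _ n]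
    by (auto simp: filled_cells_def L_filled simp del: not_None_eq)
  have rows: "\<exists>x. {j. (i, j) \<in> filled_cells n L} = {x mod n, (x + 2) mod n, (x + 4) mod n} \<and>
      [i = x + \<beta> + 4] (mod n)" if "i < n" for i
  proof -
    \<comment> \<open>This is \<open>i - (\<beta> + 4)\<close> modulo \<open>n\<close>; the natural
      subtraction is exact as \<open>\<beta> + 4 < n\<close>.\<close>
    define x where "x = i + (n - (\<beta> + 4))"
    have "x + \<beta> + 4 = i + n" using n by (simp add: x_def)
    then have ix: "[i = x + \<beta> + 4] (mod n)" by (simp add: cong_def)
    have step: "[i = j + \<beta> + m] (mod n) \<longleftrightarrow> [j = x + l] (mod n)" if "m + l = 4" for j m l
    proof -
      have "x + \<beta> + 4 = (x + l) + (\<beta> + m)" using that by simp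
      then have "[i = (x + l) + (\<beta> + m)] (mod n)" using ix by (simp only:)
      then have "[i = j + \<beta> + m] (mod n) \<longleftrightarrow> [j + (\<beta> + m) = (x + l) + (\<beta> + m)] (mod n)"
        by (metis add.assoc cong_sym cong_trans)
      then show ?thesis by (simp only: cong_add_rcancel_nat)
    qed
    have "j < n \<and> L i j \<noteq> None \<longleftrightarrow> j \<in> {x mod n, (x + 2) mod n, (x + 4) mod n}" for j
      using n0 step[of 0 4 j] step[of 2 2 j] step[of 4 0 j] cong_iff_eq_mod[of j n]
      by (auto simp: L_filled simp del: not_None_eq)
    then show ?thesis using ix that by (auto simp: filled_cells_def)
  qed
  have filled: "filled_cells n L = diagonal n \<beta> \<union> diagonal n (\<beta> + 2) \<union> diagonal n (\<beta> + 4)"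
  proof -
    have "(i, j) \<in> filled_cells n L \<longleftrightarrow>
        j < n \<and> i \<in> {(j + \<beta>) mod n, (j + \<beta> + 2) mod n, (j + \<beta> + 4) mod n}" for i j
      using columns[of j] by (auto simp: filled_cells_def)
    then show ?thesis by (auto simp: diagonal_def add.assoc)
  qed
  have entries: "entries_on L (diagonal n \<beta>) = range a"
    "entries_on L (diagonal n (\<beta> + 2)) = range b"
    "entries_on L (diagonal n (\<beta> + 4)) = range c"
    using L by (auto simp: entries_on_def diagonal_def images[symmetric] cong_def add.assoc)
  have "entries_on L (S \<union> T) = entries_on L S \<union> entries_on L T" for S T
    by (auto simp: entries_on_def)
  then show "three_diagonal_properties n \<beta> L"
    using filled suppb suppac pos neg
    by (simp add: three_diagonal_properties_def support_on_def entries del: add_2_eq_Suc')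
  show "heffter_array n 3 L"
    unfolding heffter_array_def
  proof (intro conjI allI impI)
    fix i assume i: "i < n"
    obtain x where x: "{j. (i, j) \<in> filled_cells n L} = {x mod n, (x + 2) mod n, (x + 4) mod n}"
      and ix: "[i = x + \<beta> + 4] (mod n)" using rows[OF i] by blast
    show "card {j. (i, j) \<in> filled_cells n L} = 3"
      unfolding x using card3[of x] by simp
    have cells: "[i = (x + l) mod n + (\<beta> + m)] (mod n)" if "m + l = 4" for l m
    proof -
      have "x + \<beta> + 4 = (x + l) + (\<beta> + m)" using that by simp
      then show ?thesis using ix by (simp only: cong_def mod_add_left_eq)
    qed
    have "L i ((x + 4) mod n) = Some (a ((x + 4) mod n))"
      "L i ((x + 2) mod n) = Some (b ((x + 2) mod n))"
      "L i (x mod n) = Some (c (x mod n))"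
      using cells[of 0 4] cells[of 2 2] cells[of 4 0] by (simp_all add: L add.assoc del: add_2_eq_Suc')
    then have "(\<Sum>j | (i, j) \<in> filled_cells n L. the (L i j)) = 0"
      unfolding x using card3[of x] row[of x] by (simp add: per)
    then show "[(\<Sum>j | (i, j) \<in> filled_cells n L. the (L i j)) = 0] (mod (2 * int n * int 3 + 1))"
      by simp
  next
    fix j assume j: "j < n"
    show "card {i. (i, j) \<in> filled_cells n L} = 3"
      unfolding columns[OF j] using card3[of "j + \<beta>"] by simp
    have "(\<Sum>i | (i, j) \<in> filled_cells n L. the (L i j)) = 0"
      unfolding columns[OF j] using card3[of "j + \<beta>"] col[of j] by (simp add: L cong_def)
    then show "[(\<Sum>i | (i, j) \<in> filled_cells n L. the (L i j)) = 0] (mod (2 * int n * int 3 + 1))"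
      by simp
  next
    fix x :: int assume x: "1 \<le> x \<and> x \<le> int n * int 3"
    \<comment> \<open>The two support hypotheses together cover 1 to \<open>3 n\<close>.\<close>
    have "x \<in> abs ` range b \<union> abs ` (range a \<union> range c)"
      unfolding suppb suppac using x by auto
    then obtain v where "v \<in> range a \<union> range b \<union> range c" and "x = \<bar>v\<bar>"
      by blast
    then have v: "x = v \<or> x = - v" by linarith
    obtain j where j: "j < n" and "v = a j \<or> v = b j \<or> v = c j"
      using \<open>v \<in> _\<close> unfolding images[symmetric] by blast
    then consider "v = a j" | "v = b j" | "v = c j" by blast
    then have "\<exists>m. L (m mod n) j = Some v"
    proof cases
      case 1
      then show ?thesis by (intro exI[of _ "j + \<beta>"]) (simp add: L(1) cong_def)
    next
      case 2
      then show ?thesis by (intro exI[of _ "j + \<beta> + 2"]) (simp add: L(2) cong_def)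
    next
      case 3
      then show ?thesis by (intro exI[of _ "j + \<beta> + 4"]) (simp add: L(3) cong_def)
    qed
    then obtain i where "i < n" "L i j = Some v"
      using n0 mod_less_divisor by blast
    moreover have "v = x \<or> v = - x" using v by auto
    ultimately have "L i j = Some x \<or> L i j = Some (- x)" by auto
    then show "\<exists>i<n. \<exists>j<n. L i j = Some x \<or> L i j = Some (- x)"
      using j \<open>i < n\<close> by blast
  qed
qed

section \<open>The zigzag labelling and its neighbour sums\<close>

text \<open>The values \<open>d t\<close> of the overview for \<open>n = 4 k + 1\<close>: parity
  chooses between \<open>8 k + 3 + r t\<close> and \<open>8 k + 2 - r t\<close>, and
  \<open>t \<le> 2 * k\<close> selects the first zigzag.\<close>

definition zigzag :: "nat \<Rightarrow> nat \<Rightarrow> int" where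
  "zigzag k t =
     (if t \<le> 2 * k
      then if even t then 9 * int k + 3 - int (t div 2) else 5 * int k + 1 - int (t div 2)
      else if even t then 9 * int k + 3 + int (t div 2) else 5 * int k + 2 + int (t div 2))"

text \<open>The intervals come, in this order, from odd \<open>t < 2 k\<close>, odd
  \<open>t > 2 k\<close>, even \<open>t \<le> 2 k\<close> and even \<open>t > 2 k\<close>. Preimages
  are found by solving each linear branch.\<close>

lemma zigzag_image:
  "zigzag k ` {..4 * k} = {4 * int k + 2..5 * int k + 1} \<union> {6 * int k + 2..7 * int k + 1}
     \<union> {8 * int k + 3..9 * int k + 3} \<union> {10 * int k + 4..11 * int k + 3}" (is "?l = ?r")
proof
  show "?l \<subseteq> ?r"
  proof
    fix y assume "y \<in> ?l"
    then obtain t where t: "t \<le> 4 * k" "y = zigzag k t" by auto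
    show "y \<in> ?r"
    proof (cases "even t")
      case True
      then obtain i where "t = 2 * i" by (rule evenE)
      with t show ?thesis by (auto simp: zigzag_def)
    next
      case False
      then obtain i where "t = 2 * i + 1" by (rule oddE)
      with t show ?thesis by (auto simp: zigzag_def)
    qed
  qed
  show "?r \<subseteq> ?l"
  proof
    fix y assume "y \<in> ?r"
    then consider "4 * int k + 2 \<le> y \<and> y \<le> 5 * int k + 1" | "6 * int k + 2 \<le> y \<and> y \<le> 7 * int k + 1"
      | "8 * int k + 3 \<le> y \<and> y \<le> 9 * int k + 3" | "10 * int k + 4 \<le> y \<and> y \<le> 11 * int k + 3"
      by auto
    then show "y \<in> ?l"
    proof cases
      case 1
      then show ?thesis
        by (intro image_eqI[of _ _ "2 * nat (5 * int k + 1 - y) + 1"]) (auto simp: zigzag_def)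
    next
      case 2
      then show ?thesis
        by (intro image_eqI[of _ _ "2 * nat (y - 5 * int k - 2) + 1"]) (auto simp: zigzag_def)
    next
      case 3
      then show ?thesis
        by (intro image_eqI[of _ _ "2 * nat (9 * int k + 3 - y)"]) (auto simp: zigzag_def)
    next
      case 4
      then show ?thesis
        by (intro image_eqI[of _ _ "2 * nat (y - 9 * int k - 3)"]) (auto simp: zigzag_def)
    qed
  qed
qed

definition zigzag_cycle :: "nat \<Rightarrow> nat \<Rightarrow> int" where
  "zigzag_cycle k t = zigzag k (t mod (4 * k + 1))"

text \<open>As \<open>16 k + 5 = 4 n + 1\<close>, for \<open>t < 4 k\<close> this is the difference
  of two neighbouring labels \<open>r\<close> up to sign.\<close>

definition cycle_sum :: "nat \<Rightarrow> nat \<Rightarrow> int" where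
  "cycle_sum k t = zigzag_cycle k t + zigzag_cycle k (Suc t) - (16 * int k + 5)"

lemma zigzag_cycle_periodic: "zigzag_cycle k (t mod (4 * k + 1)) = zigzag_cycle k t"
  by (simp add: zigzag_cycle_def)

lemma cycle_sum_periodic: "cycle_sum k (t mod (4 * k + 1)) = cycle_sum k t"
  by (simp add: cycle_sum_def zigzag_cycle_def mod_Suc_eq)

lemma range_zigzag_cycle: "range (zigzag_cycle k) = zigzag k ` {..4 * k}"
proof -
  have "range (zigzag_cycle k) = zigzag_cycle k ` {..<4 * k + 1}"
    by (rule image_lessThan_periodic[symmetric]) (simp_all add: zigzag_cycle_periodic del: One_nat_def)
  also have "\<dots> = zigzag k ` {..4 * k}"
    by (intro image_cong) (auto simp: zigzag_cycle_def)
  finally show ?thesis .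
qed

text \<open>The cases are the first zigzag, the edge joining the zigzags, the second zigzag and the
  edge closing the cycle. For \<open>k = 0\<close> only the closing edge exists, hence the guard
  \<open>0 < k\<close>.\<close>

lemma cycle_sum_even:
  "i \<le> 2 * k \<Longrightarrow> cycle_sum k (2 * i) =
     (if i < k then - 2 * int k - 1 - 2 * int i
      else if i = k \<and> 0 < k then - 2 * int k
      else if i < 2 * k then 2 * int i - 2 * int k else 4 * int k + 1)"
  by (cases "i = 2 * k") (auto simp: cycle_sum_def zigzag_cycle_def zigzag_def)

lemma cycle_sum_odd:
  "i < 2 * k \<Longrightarrow> cycle_sum k (2 * i + 1) =
     (if i < k then - 2 * int k - 2 - 2 * int i else 2 * int i + 1 - 2 * int k)"
  by (auto simp: cycle_sum_def zigzag_cycle_def zigzag_def)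

text \<open>The second zigzag supplies 1 to \<open>2 k - 1\<close>, the joining edge
  \<open>2 k\<close>, the first zigzag \<open>2 k + 1\<close> to \<open>4 k\<close>, and the closing
  edge \<open>4 k + 1\<close>.\<close>

lemma abs_range_cycle_sum:
  assumes "0 < k"
  shows "abs ` range (cycle_sum k) = {1..4 * int k + 1}" (is "?l = ?r")
proof
  have range: "range (cycle_sum k) = cycle_sum k ` {..<4 * k + 1}"
    by (rule image_lessThan_periodic[symmetric]) (simp_all add: cycle_sum_periodic del: One_nat_def)
  show "?l \<subseteq> ?r"
  proof
    fix y assume "y \<in> ?l"
    then obtain t where t: "t \<le> 4 * k" "y = \<bar>cycle_sum k t\<bar>"
      unfolding range by (auto simp: less_Suc_eq_le)
    show "y \<in> ?r"
    proof (cases "even t")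
      case True
      then obtain i where "t = 2 * i" by (rule evenE)
      with t cycle_sum_even[of i k] assms show ?thesis by (auto split: if_splits)
    next
      case False
      then obtain i where "t = 2 * i + 1" by (rule oddE)
      with t cycle_sum_odd[of i k] show ?thesis by (auto split: if_splits)
    qed
  qed
  show "?r \<subseteq> ?l"
  proof
    fix y :: int assume "y \<in> ?r"
    then have y: "1 \<le> y" "y \<le> 4 * int k + 1" by auto
    have "\<exists>t. \<bar>cycle_sum k t\<bar> = y"
    proof (cases "even y")
      case True
      then obtain z where z: "y = 2 * z" by (rule evenE)
      \<comment> \<open>Second zigzag at an even position, joining edge, first zigzag at an odd
        position.\<close>
      consider "z < int k" | "z = int k" | "int k < z" by linarith
      then show ?thesis
      proof cases
        case 1
        then show ?thesis using y z cycle_sum_even[of "nat (z + int k)" k]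
          by (intro exI[of _ "2 * nat (z + int k)"]) auto
      next
        case 2
        then show ?thesis using y z cycle_sum_even[of k k] by (intro exI[of _ "2 * k"]) auto
      next
        case 3
        then show ?thesis using y z cycle_sum_odd[of "nat (z - int k - 1)" k]
          by (intro exI[of _ "2 * nat (z - int k - 1) + 1"]) auto
      qed
    next
      case False
      then obtain z where z: "y = 2 * z + 1" by (rule oddE)
      \<comment> \<open>Second zigzag at an odd position, first zigzag at an even position, closing
        edge.\<close>
      consider "z < int k" | "int k \<le> z" "z < 2 * int k" | "z = 2 * int k" using y z by linarith
      then show ?thesis
      proof cases
        case 1
        then show ?thesis using y z cycle_sum_odd[of "nat (z + int k)" k]
          by (intro exI[of _ "2 * nat (z + int k) + 1"]) auto
      next
        case 2
        then show ?thesis using y z cycle_sum_even[of "nat (z - int k)" k]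
          by (intro exI[of _ "2 * nat (z - int k)"]) auto
      next
        case 3
        then show ?thesis using y z assms cycle_sum_even[of "2 * k" k]
          by (intro exI[of _ "2 * (2 * k)"]) auto
      qed
    qed
    then show "y \<in> ?l" by blast
  qed
qed

text \<open>The factor \<open>2 k + 1\<close> is the inverse of \<open>2\<close> modulo \<open>4 k + 1\<close>.\<close>

lemma range_periodic_half:
  fixes f :: "nat \<Rightarrow> 'a"
  assumes "\<And>t. f (t mod (4 * k + 1)) = f t"
  shows "range (\<lambda>j. f (j * (2 * k + 1))) = range f"
proof -
  have "f (2 * t * (2 * k + 1)) = f t" for t
  proof -
    have "2 * t * (2 * k + 1) = t + t * (4 * k + 1)" by (simp add: algebra_simps)
    then show ?thesis by (metis assms mod_mult_self1)
  qed
  then show ?thesis by (metis (no_types, lifting) image_subset_iff rangeI subset_antisym)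
qed

section \<open>Assembly of the array from the labelling\<close>

theorem theorem4p2:
  fixes n \<beta> :: nat
  assumes "[n = 1] (mod 4)"
    and "int \<beta> \<le> int n - 5"
  shows "\<exists>L. heffter_array n 3 L \<and>
             three_diagonal_properties n \<beta> L \<and>
             heffter_array n 3 (shift_array n L) \<and>
             three_diagonal_properties n \<beta> (shift_array n L)"
proof -
  define k where "k = n div 4"
  have nk: "n = 4 * k + 1" and k: "0 < k" and n: "\<beta> + 5 \<le> n" and n0: "0 < n"
    using assms unfolding k_def cong_def by simp_all presburger+
  \<comment> \<open>\<open>j * (2 * k + 1)\<close> is \<open>j / 2\<close> modulo \<open>n\<close>,
    so \<open>D (2 t)\<close> is the cyclic extension of \<open>d t\<close>.\<close>
  define D where "D = (\<lambda>j. zigzag_cycle k (j * (2 * k + 1)))"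
  define a where "a = (\<lambda>j. 16 * int k + 5 - D j)"
  define b where "b = (\<lambda>j. D j + D (j + 2) - (16 * int k + 5))"
  define c where "c = (\<lambda>j. - D (j + 2))"
  have perD: "D (j mod n) = D j" for j
    unfolding D_def zigzag_cycle_def nk by (simp only: mod_simps)
  have perD2: "D (j mod n + 2) = D (j + 2)" for j
    by (metis perD mod_add_left_eq)
  have per: "a (j mod n) = a j" "b (j mod n) = b j" "c (j mod n) = c j" for j
    by (simp_all add: a_def b_def c_def perD perD2 del: add_2_eq_Suc')
  have b_eq: "b = (\<lambda>j. cycle_sum k (j * (2 * k + 1)))"
  proof
    fix j
    \<comment> \<open>Two columns further is one step further along the cycle, so \<open>b\<close>
      is a reindexed \<open>cycle_sum\<close>.\<close>
    have "(j + 2) * (2 * k + 1) = Suc (j * (2 * k + 1)) + (4 * k + 1)" by (simp add: algebra_simps)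
    then have "D (j + 2) = zigzag_cycle k (Suc (j * (2 * k + 1)))"
      unfolding D_def zigzag_cycle_def by (simp only: mod_add_self2)
    then show "b j = cycle_sum k (j * (2 * k + 1))" by (simp add: b_def D_def cycle_sum_def)
  qed
  have suppb: "abs ` range b = {1..int n}"
    unfolding b_eq range_periodic_half[where f = "cycle_sum k", OF cycle_sum_periodic]
    by (simp add: abs_range_cycle_sum[OF k] nk add.commute)
  have rangeD: "range D = {4 * int k + 2..5 * int k + 1} \<union> {6 * int k + 2..7 * int k + 1}
     \<union> {8 * int k + 3..9 * int k + 3} \<union> {10 * int k + 4..11 * int k + 3}"
    unfolding D_def range_periodic_half[where f = "zigzag_cycle k", OF zigzag_cycle_periodic] range_zigzag_cycle
    by (rule zigzag_image)
  have D_bounds: "4 * int k + 2 \<le> D j" "D j \<le> 11 * int k + 3" for j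
    using rangeI[of D j] unfolding rangeD by auto
  have pos: "a j > 0" and neg: "c j < 0" for j
    using D_bounds[of j] D_bounds[of "j + 2"] by (auto simp: a_def c_def)
  have suppa: "abs ` range a = (\<lambda>x. 16 * int k + 5 - x) ` range D"
  proof -
    have "\<bar>a j\<bar> = 16 * int k + 5 - D j" for j using pos[of j] by (simp add: a_def)
    then show ?thesis by (simp add: image_image)
  qed
  have suppc: "abs ` range c = range D"
  proof -
    have "\<bar>c j\<bar> = ((D \<circ> Suc) \<circ> Suc) j" for j using neg[of j] by (simp add: c_def)
    then have "abs ` range c = range ((D \<circ> Suc) \<circ> Suc)" by (simp add: image_image)
    also have "\<dots> = range (D \<circ> Suc)"
      by (rule range_comp_Suc_periodic[OF n0]) (metis comp_apply mod_Suc_eq perD)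
    also have "\<dots> = range D" by (rule range_comp_Suc_periodic[where f = D, OF n0 perD])
    finally show ?thesis .
  qed
  have suppac: "abs ` (range a \<union> range c) = {int n + 1..3 * int n}"
    \<comment> \<open>The reflection \<open>16 k + 5 - x\<close> carries the four intervals of
      \<open>D\<close> exactly onto the rest of \<open>{4 k + 2..12 k + 3}\<close>, which is
      \<open>{n + 1..3 n}\<close>.\<close>
    unfolding image_Un suppa suppc rangeD image_diff_atLeastAtMost nk by auto
  have col: "a j + b j + c j = 0" and row: "a (j + 4) + b (j + 2) + c j = 0" for j
    by (simp_all add: a_def b_def c_def add.assoc del: add_2_eq_Suc')
  let ?L = "diagonal_array n \<beta> a b c"
  have "heffter_array n 3 ?L" "three_diagonal_properties n \<beta> ?L"
    using diagonal_array_properties[OF n per col row suppb suppac pos neg] by auto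
  moreover have "heffter_array n 3 (shift_array n ?L)"
    "three_diagonal_properties n \<beta> (shift_array n ?L)"
  proof -
    have per': "(f \<circ> Suc) (j mod n) = (f \<circ> Suc) j" if "\<And>j. f (j mod n) = f j" for f :: "nat \<Rightarrow> int" and j
      by (metis comp_apply mod_Suc_eq that)
    \<comment> \<open>Advancing a periodic sequence keeps its range, so the support conditions carry
      over.\<close>
    note ranges = range_comp_Suc_periodic[where f = a, OF n0 per(1)] range_comp_Suc_periodic[where f = b, OF n0 per(2)]
      range_comp_Suc_periodic[where f = c, OF n0 per(3)]
    show "heffter_array n 3 (shift_array n ?L)"
      "three_diagonal_properties n \<beta> (shift_array n ?L)"
      unfolding shift_diagonal_array[where a = a and b = b and c = c, OF per]
      using diagonal_array_properties[where a = "a \<circ> Suc" and b = "b \<circ> Suc" and c = "c \<circ> Suc",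
          OF n per'[where f = a, OF per(1)] per'[where f = b, OF per(2)] per'[where f = c, OF per(3)]]
        col[of "Suc _"] row[of "Suc _"] suppb suppac pos neg
      unfolding ranges by simp_all
  qed
  ultimately show ?thesis by blast
qed

end
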